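(* For every integer $n\ge0$, $$\sum_{k=0}^{n}(-1)^{n+k}\binom{2n+1}{n-k}a_k=1,$$ where, for every integer $k\ge 0$, $$a_k=(2k+1)+\sum_{m=2}^{k+1}\sum_{l=1}^{k}(2l-1)\binom{k+m-l-1}{2m-3}.$$
   Context: Binomial coefficients $\binom{n}{k}$ with $0\le n<k$ are $0$, and empty sums are $0$. *)

theory Defs
  imports Complex_Main
begin

text \<open>In the index range \<open>2 \<le> m\<close>, \<open>l \<le> k\<close> the natural-number subtractions in the
  binomial coefficient do not truncate.\<close>

definition a :: "nat \<Rightarrow> int" where
  "a k = (2 * int k + 1) +
     (\<Sum>m = 2..k + 1. \<Sum>l = 1..k. (2 * int l - 1) * int ((k + m - l - 1) choose (2 * m - 3)))"

end

theory Submission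
  imports Defs "HOL-Number_Theory.Fib"
begin

text \<open>
  The number \<open>a k\<close> is the Lucas number of index \<open>2 * k + 1\<close>, so it equals
  \<open>\<phi> ^ (2 * k + 1) + \<psi> ^ (2 * k + 1)\<close> for the two roots \<open>\<phi>, \<psi>\<close> of \<open>x\<^sup>2 = x + 1\<close>. These roots
  satisfy \<open>\<phi> + \<psi> = 1\<close> and \<open>\<phi> * \<psi> = -1\<close>. Expand \<open>1 = (\<phi> + \<psi>) ^ (2 * n + 1)\<close> by the
  binomial theorem and pair the two terms with equal binomial coefficient: as the product of
  the roots is \<open>-1\<close>, each pair collapses to a signed sum of two odd powers, and the
  expansion becomes the asserted sum (\<open>odd_power_sum_expansion\<close>).

  That \<open>a k\<close> is a Lucas number has two reasons. In the double sum, the inner sum over \<open>m\<close>,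
  for fixed \<open>l\<close>, runs along a diagonal of Pascal's triangle and so is a Fibonacci number of
  even index (\<open>sum_choose_odd_eq_fib\<close>). What remains is a convolution of the odd numbers
  with the Fibonacci numbers of even index; its increments are partial sums of the latter, which
  telescope (\<open>odd_fib_convolution\<close>).
\<close>

text \<open>
  The substitution \<open>i = d - s\<close> and the symmetry of binomial coefficients turn this into the
  diagonal sum of \<open>(2 * d + 1 - i) choose i\<close>. All terms with \<open>s > d\<close> vanish, so the
  upper limit \<open>N\<close> may be any number beyond \<open>d\<close>; this lets it be independent of \<open>l\<close> later.
\<close>
lemma sum_choose_odd_eq_fib:
  assumes "d < N"
  shows "(\<Sum>s<N. (d + 1 + s) choose (2 * s + 1)) = fib (2 * d + 2)"
proof -
  have "(\<Sum>s<N. (d + 1 + s) choose (2 * s + 1)) = (\<Sum>s\<le>d. (d + 1 + s) choose (2 * s + 1))"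
    using assms by (intro sum.mono_neutral_right) auto
  also have "\<dots> = (\<Sum>i\<le>d. (2 * d + 1 - i) choose i)"
  proof (rule sum.reindex_bij_witness[of _ "\<lambda>i. d - i" "\<lambda>s. d - s"])
    fix s assume "s \<in> {..d}"
    then show "(2 * d + 1 - (d - s)) choose (d - s) = (d + 1 + s) choose (2 * s + 1)"
      by (subst binomial_symmetric) (auto intro!: arg_cong2[of _ _ _ _ binomial])
  qed auto
  also have "\<dots> = (\<Sum>i = 0..2 * d + 1. (2 * d + 1 - i) choose i)"
    by (intro sum.mono_neutral_left) auto
  also have "\<dots> = fib (2 * d + 2)"
    using ne_diagonal_fib[of "2 * d + 1"] by simp
  finally show ?thesis .
qed

lemma sum_fib_even: "(\<Sum>i<k. int (fib (2 * i + 2))) = int (fib (2 * k + 1)) - 1"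
  by (induction k) (auto simp: numeral_2_eq_2)

text \<open>
  Passing from \<open>k\<close> to \<open>k + 1\<close> raises every coefficient by \<open>2\<close> and adds the term
  \<open>fib (2 * k + 2)\<close>, so the increment is known from the partial sums of the Fibonacci
  numbers with even index.
\<close>
lemma odd_fib_convolution:
  "(2 * int k + 1) + (\<Sum>i<k. (2 * int (k - i) - 1) * int (fib (2 * i + 2)))
    = int (fib (2 * k)) + int (fib (2 * k + 2))"
proof (induction k)
  case 0
  show ?case by (simp add: numeral_2_eq_2)
next
  case (Suc k)
  have "(\<Sum>i<k. (2 * int (Suc k - i) - 1) * int (fib (2 * i + 2)))
      = (\<Sum>i<k. (2 * int (k - i) - 1) * int (fib (2 * i + 2)) + 2 * int (fib (2 * i + 2)))"
    by (intro sum.cong) (auto simp: of_nat_diff algebra_simps)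
  also have "\<dots> = (\<Sum>i<k. (2 * int (k - i) - 1) * int (fib (2 * i + 2)))
      + 2 * (int (fib (2 * k + 1)) - 1)"
    by (simp only: sum.distrib flip: sum_distrib_left sum_fib_even)
  finally show ?case
    using Suc.IH by (simp add: numeral_2_eq_2)
qed

text \<open>The right-hand side is the Lucas number of index \<open>2 * k + 1\<close>.\<close>
lemma a_eq_fib: "a k = int (fib (2 * k)) + int (fib (2 * k + 2))"
proof -
  have inner: "(\<Sum>m = 2..k + 1. int ((k + m - l - 1) choose (2 * m - 3)))
      = int (fib (2 * (k - l) + 2))" if "l \<in> {1..k}" for l
  proof -
    have "(\<Sum>m = 2..k + 1. int ((k + m - l - 1) choose (2 * m - 3)))
        = (\<Sum>s<k. int ((k - l + 1 + s) choose (2 * s + 1)))"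
    proof (rule sum.reindex_bij_witness[of _ "\<lambda>s. s + 2" "\<lambda>m. m - 2"])
      fix m assume "m \<in> {2..k + 1}"
      then have "k - l + 1 + (m - 2) = k + m - l - 1" and "2 * (m - 2) + 1 = 2 * m - 3"
        using that by auto
      then show "int ((k - l + 1 + (m - 2)) choose (2 * (m - 2) + 1))
          = int ((k + m - l - 1) choose (2 * m - 3))"
        by (simp only:)
    qed auto
    also have "\<dots> = int (fib (2 * (k - l) + 2))"
      using that by (subst of_nat_sum[symmetric], subst sum_choose_odd_eq_fib) auto
    finally show ?thesis .
  qed
  have "(\<Sum>m = 2..k + 1. \<Sum>l = 1..k. (2 * int l - 1) * int ((k + m - l - 1) choose (2 * m - 3)))
      = (\<Sum>l = 1..k. (2 * int l - 1) * (\<Sum>m = 2..k + 1. int ((k + m - l - 1) choose (2 * m - 3))))"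
    by (subst sum.swap) (simp only: sum_distrib_left)
  also have "\<dots> = (\<Sum>l = 1..k. (2 * int l - 1) * int (fib (2 * (k - l) + 2)))"
    by (intro sum.cong refl) (simp only: inner)
  also have "\<dots> = (\<Sum>i<k. (2 * int (k - i) - 1) * int (fib (2 * i + 2)))"
    by (rule sum.reindex_bij_witness[of _ "\<lambda>i. k - i" "\<lambda>l. k - l"]) auto
  finally show ?thesis
    using odd_fib_convolution[of k] by (simp only: a_def)
qed

text \<open>
  Both sides satisfy the Fibonacci recurrence in \<open>n\<close>: the left one because \<open>x\<close> and \<open>y\<close> are
  the roots of \<open>t\<^sup>2 = t + 1\<close>.
\<close>
lemma power_sum_eq_fib:
  fixes x y :: "'a :: comm_ring_1"
  assumes "x + y = 1" and "x * y = -1"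
  shows "x ^ Suc n + y ^ Suc n = of_nat (fib n + fib (n + 2))"
proof (induction n rule: fib.induct)
  case 1
  show ?case using assms by (simp add: numeral_2_eq_2)
next
  case 2
  have "x\<^sup>2 + y\<^sup>2 = (x + y)\<^sup>2 - 2 * (x * y)"
    by (simp add: power2_eq_square algebra_simps)
  then show ?case using assms by (simp add: numeral_3_eq_3 numeral_2_eq_2)
next
  case (3 n)
  have "x ^ (m + 2) + y ^ (m + 2)
      = (x + y) * (x ^ Suc m + y ^ Suc m) - x * y * (x ^ m + y ^ m)" for m
    by (simp add: algebra_simps)
  from this[of "Suc n"] show ?case
    using 3 assms by (simp add: algebra_simps)
qed

text \<open>
  The terms of \<open>(x + y) ^ (2 * n + 1)\<close> with exponents \<open>n - k\<close> and \<open>n + k + 1\<close> have equal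
  binomial coefficients and the common factor \<open>(x * y) ^ (n - k)\<close>.
\<close>
lemma odd_power_sum_expansion:
  fixes x y :: "'a :: comm_ring_1"
  shows "(x + y) ^ (2 * n + 1)
    = (\<Sum>k = 0..n. (x * y) ^ (n - k) * of_nat ((2 * n + 1) choose (n - k))
        * (x ^ (2 * k + 1) + y ^ (2 * k + 1)))"
proof -
  define t where "t j = of_nat ((2 * n + 1) choose j) * x ^ j * y ^ (2 * n + 1 - j)" for j
  have split: "{..2 * n + 1} = {..n} \<union> {Suc n..2 * n + 1}"
    by auto
  have low: "t (n - k) = (x * y) ^ (n - k) * of_nat ((2 * n + 1) choose (n - k)) * y ^ (2 * k + 1)"
    if "k \<le> n" for k
  proof -
    have "2 * n + 1 - (n - k) = (n - k) + (2 * k + 1)"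
      using that by simp
    then have "y ^ (2 * n + 1 - (n - k)) = y ^ (n - k) * y ^ (2 * k + 1)"
      by (simp only: power_add)
    then show ?thesis
      by (simp only: t_def power_mult_distrib mult_ac)
  qed
  have high: "t (Suc n + k)
      = (x * y) ^ (n - k) * of_nat ((2 * n + 1) choose (n - k)) * x ^ (2 * k + 1)"
    if "k \<le> n" for k
  proof -
    have "Suc n + k = (n - k) + (2 * k + 1)"
      using that by simp
    then have "x ^ (Suc n + k) = x ^ (n - k) * x ^ (2 * k + 1)"
      by (simp only: power_add)
    moreover have "2 * n + 1 - (Suc n + k) = n - k"
      by simp
    moreover have "(2 * n + 1) choose (Suc n + k) = (2 * n + 1) choose (n - k)"
      using that by (subst binomial_symmetric) auto
    ultimately show ?thesis
      by (simp only: t_def power_mult_distrib mult_ac)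
  qed
  have "(x + y) ^ (2 * n + 1) = (\<Sum>j\<le>2 * n + 1. t j)"
    by (simp only: binomial_ring t_def)
  also have "\<dots> = (\<Sum>j\<le>n. t j) + (\<Sum>j = Suc n..2 * n + 1. t j)"
    unfolding split by (intro sum.union_disjoint) auto
  also have "(\<Sum>j\<le>n. t j) = (\<Sum>k = 0..n. t (n - k))"
    by (rule sum.reindex_bij_witness[of _ "\<lambda>k. n - k" "\<lambda>j. n - j"]) auto
  also have "(\<Sum>j = Suc n..2 * n + 1. t j) = (\<Sum>k = 0..n. t (Suc n + k))"
    by (rule sum.reindex_bij_witness[of _ "\<lambda>k. Suc n + k" "\<lambda>j. j - Suc n"]) auto
  also have "(\<Sum>k = 0..n. t (n - k)) + (\<Sum>k = 0..n. t (Suc n + k))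
      = (\<Sum>k = 0..n. (x * y) ^ (n - k) * of_nat ((2 * n + 1) choose (n - k))
          * (x ^ (2 * k + 1) + y ^ (2 * k + 1)))"
    unfolding sum.distrib[symmetric]
    by (intro sum.cong refl, subst low, simp, subst high, simp, simp only: distrib_left add.commute)
  finally show ?thesis .
qed

theorem theorem5p1:
  fixes n :: nat
  shows "(\<Sum>k = 0..n. (-1) ^ (n + k) * int ((2 * n + 1) choose (n - k)) * a k) = 1"
proof -
  define x y :: real where "x = (1 + sqrt 5) / 2" and "y = (1 - sqrt 5) / 2"
  have sum1: "x + y = 1" and prod: "x * y = -1"
    by (simp_all add: x_def y_def field_simps)
  have lucas: "of_int (a k) = x ^ (2 * k + 1) + y ^ (2 * k + 1)" for k
    using power_sum_eq_fib[OF sum1 prod, of "2 * k"] by (simp add: a_eq_fib)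
  have sign: "(-1) ^ (n + k) = ((-1) ^ (n - k) :: int)" if "k \<le> n" for k
    using that by (simp add: minus_one_power_iff)
  have "real_of_int (\<Sum>k = 0..n. (-1) ^ (n + k) * int ((2 * n + 1) choose (n - k)) * a k)
      = (\<Sum>k = 0..n. (x * y) ^ (n - k) * of_nat ((2 * n + 1) choose (n - k))
          * (x ^ (2 * k + 1) + y ^ (2 * k + 1)))"
    unfolding of_int_sum lucas[symmetric] by (intro sum.cong refl) (simp add: sign prod)
  also have "\<dots> = 1"
    by (simp only: sum1 power_one flip: odd_power_sum_expansion)
  finally show ?thesis
    by linarith
qed

end
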